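(* For every permutation $\alpha\in S_n$ of genus $1$ there exist a noncrossing partition $P$ of $\{1,\dots,n\}$ and a four-coloring $\gamma$ such that $\alpha=\Phi(P,\gamma)$.
   Context: Permutations are composed right to left; $\zeta_n=(1,2,\dots,n)$; $z(\pi)$ is the number of cycles of $\pi$; the genus $g(\alpha)$ of $\alpha\in S_n$ is defined by $n+1-2g(\alpha)=z(\alpha)+z(\alpha^{-1}\zeta_n)$. A partition $P$ of $\{1,\dots,n\}$ is identified with the permutation $\beta_P$ whose cycles are its blocks written in increasing order; it is noncrossing if there are no $a<b<a'<b'$ with $a,a'$ in one block and $b,b'$ in another. A four-coloring $\gamma=(A,B,C,D)$ is given by integers $1\le i<j\le k<\ell\le n$: $A=\{\ell+1,\dots,n\}\cup\{1,\dots,i\}$, $B=\{i+1,\dots,j\}$, $C=\{j+1,\dots,k\}$, $D=\{k+1,\dots,\ell\}$. Define $\phi\in S_n$ by $\phi(x)=x$ on $A$, $\phi(x)=x+\ell-j$ on $B$, $\phi(x)=x+i+\ell-j-k$ on $C$, $\phi(x)=x+i-k$ on $D$, and $\Phi(P,\gamma)=\phi\beta_P\phi^{-1}$. *)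

theory Defs
  imports Complex_Main "HOL-Library.Disjoint_Sets" "HOL-Combinatorics.Combinatorics"
begin

text \<open>
  Elements of $S_n$ are functions on \<open>nat\<close> that permute \<open>{1..n}\<close> (and hence fix everything
  outside it); the product is \<open>\<circ>\<close>, i.e. permutations are composed right to left.
\<close>

definition zeta :: "nat \<Rightarrow> nat \<Rightarrow> nat" where
  "zeta n = cycle_of_list [1..<Suc n]"

text \<open>Fixed points count as cycles of length one.\<close>

definition num_cycles :: "nat \<Rightarrow> (nat \<Rightarrow> nat) \<Rightarrow> nat" where
  "num_cycles n p = card (orbit p ` {1..n})"

text \<open>
  The solution $g$ of $n + 1 - 2g = z(\alpha) + z(\alpha^{-1}\zeta_n)$, taken in the rationals so
  that neither the subtraction nor the division by two loses information.
\<close>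

definition genus :: "nat \<Rightarrow> (nat \<Rightarrow> nat) \<Rightarrow> rat" where
  "genus n \<alpha> =
     (of_nat n + 1 - of_nat (num_cycles n \<alpha>) - of_nat (num_cycles n (inv \<alpha> \<circ> zeta n))) / 2"

definition noncrossing_partition :: "nat \<Rightarrow> nat set set \<Rightarrow> bool" where
  "noncrossing_partition n P \<longleftrightarrow>
     partition_on {1..n} P \<and>
     (\<forall>X\<in>P. \<forall>Y\<in>P. X \<noteq> Y \<longrightarrow>
        \<not> (\<exists>a\<in>X. \<exists>b\<in>Y. \<exists>a'\<in>X. \<exists>b'\<in>Y. a < b \<and> b < a' \<and> a' < b'))"

text \<open>The permutation whose cycles are the blocks of \<open>P\<close>, each written in increasing order.\<close>

definition block_perm :: "nat set set \<Rightarrow> nat \<Rightarrow> nat" where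
  "block_perm P x =
     (if x \<in> \<Union>P then cycle_of_list (sorted_list_of_set (THE X. X \<in> P \<and> x \<in> X)) x else x)"

text \<open>
  A four-coloring is represented by its parameters \<open>(i, j, k, l)\<close>; the color classes
  $A$, $B$, $C$, $D$ are recovered by the following four functions. Only \<open>C\<close> can be empty.
\<close>

type_synonym coloring = "nat \<times> nat \<times> nat \<times> nat"

definition four_coloring :: "nat \<Rightarrow> coloring \<Rightarrow> bool" where
  "four_coloring n = (\<lambda>(i, j, k, l). 1 \<le> i \<and> i < j \<and> j \<le> k \<and> k < l \<and> l \<le> n)"

definition color_A :: "nat \<Rightarrow> coloring \<Rightarrow> nat set" where
  "color_A n = (\<lambda>(i, j, k, l). {l+1..n} \<union> {1..i})"

definition color_B :: "coloring \<Rightarrow> nat set" where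
  "color_B = (\<lambda>(i, j, k, l). {i+1..j})"

definition color_C :: "coloring \<Rightarrow> nat set" where
  "color_C = (\<lambda>(i, j, k, l). {j+1..k})"

definition color_D :: "coloring \<Rightarrow> nat set" where
  "color_D = (\<lambda>(i, j, k, l). {k+1..l})"

text \<open>
  For a four-coloring none of the subtractions below truncates, since $l > j$, and
  $x > j$ on $C$, and $x > k$ on $D$. The last branch covers $A$ and the numbers outside
  \<open>{1..n}\<close>.
\<close>

definition phi :: "coloring \<Rightarrow> nat \<Rightarrow> nat" where
  "phi \<gamma> x = (case \<gamma> of (i, j, k, l) \<Rightarrow>
     if x \<in> color_B \<gamma> then x + l - j
     else if x \<in> color_C \<gamma> then x + i + l - j - k
     else if x \<in> color_D \<gamma> then x + i - k
     else x)"

text \<open>Sanity checks: the classes cover \<open>{1..n}\<close>, and \<open>phi\<close> and \<open>zeta\<close> are as described.\<close>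

lemma colors_cover:
  assumes "four_coloring n \<gamma>"
  shows "color_A n \<gamma> \<union> color_B \<gamma> \<union> color_C \<gamma> \<union> color_D \<gamma> = {1..n}"
  using assms
  by (auto simp: four_coloring_def color_A_def color_B_def color_C_def color_D_def)

lemma phi_on_A:
  assumes "four_coloring n \<gamma>" "x \<in> color_A n \<gamma>"
  shows "phi \<gamma> x = x"
  using assms
  by (auto simp: phi_def four_coloring_def color_A_def color_B_def color_C_def color_D_def)

lemma phi_permutes:
  assumes "four_coloring n \<gamma>"
  shows "phi \<gamma> permutes {1..n}"
proof (rule bij_imp_permutes)
  obtain i j k l where g: "\<gamma> = (i, j, k, l)" by (cases \<gamma>) auto
  have h: "1 \<le> i" "i < j" "j \<le> k" "k < l" "l \<le> n"
    using assms by (auto simp: g four_coloring_def)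
  have inj: "inj_on (phi \<gamma>) {1..n}"
    using h by (auto simp: inj_on_def phi_def g color_B_def color_C_def color_D_def
        split: if_splits)
  have "phi \<gamma> ` {1..n} \<subseteq> {1..n}"
    using h by (auto simp: phi_def g color_B_def color_C_def color_D_def)
  then show "bij_betw (phi \<gamma>) {1..n} {1..n}"
    using inj by (simp add: bij_betw_def endo_inj_surj)
  show "phi \<gamma> x = x" if "x \<notin> {1..n}" for x
    using that h by (auto simp: phi_def g color_B_def color_C_def color_D_def)
qed

lemma zeta_apply:
  assumes "1 \<le> x" "x \<le> n"
  shows "zeta n x = (if x = n then 1 else x + 1)"
proof -
  have "map (zeta n) [1..<Suc n] = rotate1 [1..<Suc n]"
    using cyclic_rotation[of "[1..<Suc n]" 1] by (simp add: zeta_def)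
  then have "map (zeta n) [1..<Suc n] ! (x - 1) = rotate1 [1..<Suc n] ! (x - 1)" by simp
  then show ?thesis using assms
    by (cases "x = n") (auto simp: nth_rotate1 simp del: upt_Suc)
qed

definition Phi :: "nat set set \<Rightarrow> coloring \<Rightarrow> nat \<Rightarrow> nat" where
  "Phi P \<gamma> = phi \<gamma> \<circ> block_perm P \<circ> inv (phi \<gamma>)"

end

theory Submission
  imports Defs
begin

text \<open>
  Put $\kappa = \alpha^{-1}\zeta_n$. If $\kappa$ is not a noncrossing partition, there are $x$ and
  $u$ such that $u$ lies on the cyclic arc from $x$ to $\kappa(x)$ but $\kappa(u)$ does not. Let
  $\sigma$ be the product of the transpositions $(x, \kappa(x))$ and $(u, \kappa(u))$: each of them
  splits a fixed point off a cycle, so $\kappa\sigma$ has two more cycles than $\kappa$, whereas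
  $\zeta_n\sigma$ is the $n$-cycle $\phi\zeta_n\phi^{-1}$ of some four-coloring (with $C$ empty if
  $\kappa(u) = x$). Since $\alpha^{-1}(\zeta_n\sigma) = \kappa\sigma$, this lowers the genus by one.

  If $\alpha$ has genus $1$, so does $\kappa$, which is then not a noncrossing partition; hence
  $\phi^{-1}\alpha\phi$ has genus $0$. It is a noncrossing partition, as otherwise the same
  construction would lead to negative genus.
\<close>

section \<open>Orbits, and the effect of a transposition on the number of cycles\<close>

lemma permutation_if_permutes: "p permutes {1..n::nat} \<Longrightarrow> permutation p"
  by (auto simp: permutation_permutes)

lemma self_in_orbit: "p permutes {1..n::nat} \<Longrightarrow> x \<in> orbit p x"
  by (simp add: permutation_self_in_orbit permutation_if_permutes)

lemma orbit_eq_if_mem: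
  assumes "p permutes {1..n::nat}" "y \<in> orbit p x"
  shows "orbit p y = orbit p x"
  using assms cyclic_on_orbit' orbit_cyclic_eq3 permutation_if_permutes by metis

lemma orbit_subset_if_invariant:
  assumes "x \<in> A" "\<And>a. a \<in> A \<Longrightarrow> f a \<in> A"
  shows "orbit f x \<subseteq> A"
proof
  fix y assume "y \<in> orbit f x"
  then show "y \<in> A" by induct (auto simp: assms)
qed

text \<open>Right multiplication by \<open>transpose x y\<close> leaves these cycles unaffected, so
  each cycle count below reduces to whether \<open>x\<close> and \<open>y\<close> share an
  orbit.\<close>

definition orbits_avoiding :: "nat \<Rightarrow> (nat \<Rightarrow> nat) \<Rightarrow> nat \<Rightarrow> nat \<Rightarrow> nat set set" where
  "orbits_avoiding n p x y = {U \<in> orbit p ` {1..n}. x \<notin> U \<and> y \<notin> U}"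

lemma num_cycles_split:
  assumes p: "p permutes {1..n}" and xy: "x \<in> {1..n}" "y \<in> {1..n}"
  shows "num_cycles n p = card (orbits_avoiding n p x y) + card {orbit p x, orbit p y}"
proof -
  have "orbit p ` {1..n} = orbits_avoiding n p x y \<union> {orbit p x, orbit p y}"
    using xy orbit_eq_if_mem[OF p] by (fastforce simp: orbits_avoiding_def)
  moreover have "orbits_avoiding n p x y \<inter> {orbit p x, orbit p y} = {}"
    using self_in_orbit[OF p] by (auto simp: orbits_avoiding_def)
  moreover have "finite (orbits_avoiding n p x y)"
    by (simp add: orbits_avoiding_def)
  ultimately show ?thesis
    unfolding num_cycles_def by (metis card_Un_disjoint finite.emptyI finite_insert)
qed

text \<open>Off \<open>x\<close> and \<open>y\<close> the product agrees with \<open>p\<close>, so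
  an orbit missing both persists. The transposition being an involution, the same argument run from
  the product back to \<open>p\<close> gives the other inclusion.\<close>

lemma orbits_avoiding_transpose:
  assumes p: "p permutes {1..n}" and xy: "x \<in> {1..n}" "y \<in> {1..n}"
  shows "orbits_avoiding n (p \<circ> transpose x y) x y = orbits_avoiding n p x y"
proof -
  have sub: "orbits_avoiding n q x y \<subseteq> orbits_avoiding n (q \<circ> transpose x y) x y"
    if q: "q permutes {1..n}" for q
  proof
    fix U assume U: "U \<in> orbits_avoiding n q x y"
    then obtain w where w: "w \<in> {1..n}" "U = orbit q w" and nin: "x \<notin> U" "y \<notin> U"
      by (auto simp: orbits_avoiding_def)
    have "orbit (q \<circ> transpose x y) w = orbit q w"
      by (rule orbit_cong) (use w nin self_in_orbit[OF q] in \<open>auto simp: transpose_def\<close>)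
    then show "U \<in> orbits_avoiding n (q \<circ> transpose x y) x y"
      using w nin by (auto simp: orbits_avoiding_def)
  qed
  have "p \<circ> transpose x y permutes {1..n}"
    using p xy by (intro permutes_compose permutes_swap_id)
  from sub[OF this] sub[OF p] show ?thesis
    by (auto simp: comp_assoc)
qed

lemma card_pair: "card {a, b} = (if a = b then 1 else 2)"
  by auto

lemma num_cycles_transpose_split:
  assumes p: "p permutes {1..n}" and xy: "x \<in> {1..n}" "y \<in> {1..n}"
  shows "num_cycles n (p \<circ> transpose x y) =
    card (orbits_avoiding n p x y) +
    card {orbit (p \<circ> transpose x y) x, orbit (p \<circ> transpose x y) y}"
proof -
  have "p \<circ> transpose x y permutes {1..n}"
    using p xy by (intro permutes_compose permutes_swap_id)
  from num_cycles_split[OF this xy] show ?thesis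
    by (simp add: orbits_avoiding_transpose[OF p xy])
qed

lemma num_cycles_transpose_bounds:
  assumes "p permutes {1..n}" "x \<in> {1..n}" "y \<in> {1..n}"
  shows "num_cycles n p \<le> num_cycles n (p \<circ> transpose x y) + 1"
  unfolding num_cycles_transpose_split[OF assms] num_cycles_split[OF assms]
  by (simp add: card_pair)

text \<open>The product fixes \<open>p x\<close>, so \<open>x\<close> and \<open>p x\<close>, which
  share a cycle of \<open>p\<close>, end up in different cycles.\<close>

lemma num_cycles_detach:
  assumes p: "p permutes {1..n}" and x: "x \<in> {1..n}" and ne: "p x \<noteq> x"
  shows "num_cycles n (p \<circ> transpose x (p x)) = num_cycles n p + 1"
proof -
  let ?y = "p x" and ?q = "p \<circ> transpose x (p x)"
  have y: "?y \<in> {1..n}"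
    using permutes_in_image[OF p] x by auto
  have q: "?q permutes {1..n}"
    using p x y by (intro permutes_compose permutes_swap_id)
  have eq: "orbit p ?y = orbit p x"
    using orbit_eq_if_mem[OF p orbit.base] .
  have "orbit ?q ?y = {?y}"
    by (simp add: orbit_eq_singleton_iff)
  then have "orbit ?q x \<noteq> orbit ?q ?y"
    using self_in_orbit[OF q, of x] ne by auto
  then show ?thesis
    unfolding num_cycles_transpose_split[OF p x y] num_cycles_split[OF p x y]
    by (simp add: card_pair eq)
qed

text \<open>The product sends \<open>x\<close> to \<open>p y\<close> and then follows the
  \<open>p\<close>-cycle of \<open>y\<close>, which avoids \<open>x\<close>, until it reaches
  \<open>y\<close>; two cycles have become one.\<close>

lemma num_cycles_join:
  assumes p: "p permutes {1..n}" and xy: "x \<in> {1..n}" "y \<in> {1..n}"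
    and nin: "y \<notin> orbit p x"
  shows "num_cycles n p = num_cycles n (p \<circ> transpose x y) + 1"
proof -
  let ?q = "p \<circ> transpose x y"
  have q: "?q permutes {1..n}"
    using p xy by (intro permutes_compose permutes_swap_id)
  have ne: "orbit p x \<noteq> orbit p y"
    using nin self_in_orbit[OF p] by auto
  have "y \<in> orbit ?q x"
  proof (rule ccontr)
    assume n: "y \<notin> orbit ?q x"
    have "w \<in> orbit ?q x" if "w \<in> orbit p y" for w
      using that
    proof induct
      case base
      have "?q x = p y" by simp
      then show ?case using orbit.base[of ?q x] by metis
    next
      case (step w)
      have "w \<noteq> y" using n step(2) by metis
      moreover have "w \<noteq> x"
        using step(1) ne orbit_eq_if_mem[OF p] by auto
      ultimately have "?q w = p w" by simp
      then show ?case
        using orbit.step[OF step(2)] by metis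
    qed
    then show False using n self_in_orbit[OF p] by blast
  qed
  then have "orbit ?q y = orbit ?q x"
    using orbit_eq_if_mem[OF q] by blast
  then show ?thesis
    unfolding num_cycles_transpose_split[OF p xy] num_cycles_split[OF p xy]
    by (simp add: card_pair ne)
qed

text \<open>Orbits of \<open>p\<close> are carried by \<open>c\<close> onto orbits of the conjugate,
  and an injective \<open>c\<close> has an injective image map on sets.\<close>

lemma num_cycles_conj:
  assumes p: "p permutes {1..n}" and c: "c permutes {1..n}"
  shows "num_cycles n (c \<circ> p \<circ> inv c) = num_cycles n p"
proof -
  let ?q = "c \<circ> p \<circ> inv c"
  have inj: "inj c" using permutes_inj[OF c] .
  have "orbit ?q (c x) = c ` orbit p x" for x
    by (rule orbit_inverse[symmetric])
      (use self_in_orbit[OF p] inj in \<open>auto\<close>)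
  then have "orbit ?q ` c ` {1..n} = (`) c ` orbit p ` {1..n}"
    by (simp add: image_image)
  then have "orbit ?q ` {1..n} = (`) c ` orbit p ` {1..n}"
    by (simp only: permutes_image[OF c])
  moreover have "inj ((`) c)"
    using inj by (simp add: inj_image_eq_iff inj_def)
  ultimately show ?thesis
    by (simp add: num_cycles_def card_image inj_on_subset)
qed

lemma num_cycles_comp_commute:
  assumes p: "p permutes {1..n}" and c: "c permutes {1..n}"
  shows "num_cycles n (c \<circ> p) = num_cycles n (p \<circ> c)"
proof -
  have "num_cycles n (c \<circ> (p \<circ> c) \<circ> inv c) = num_cycles n (p \<circ> c)"
    using p c by (intro num_cycles_conj permutes_compose)
  moreover have "c \<circ> (p \<circ> c) \<circ> inv c = c \<circ> p"
    using permutes_inv_o(1)[OF c] by (simp add: comp_assoc)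
  ultimately show ?thesis by simp
qed

section \<open>Cycle counts of the identity and of the long cycle\<close>

lemma num_cycles_id: "num_cycles n id = n"
proof -
  have "orbit id = (\<lambda>x::nat. {x})"
    using orbit_eq_singleton_iff[of id] by (intro ext) simp
  then show ?thesis by (simp add: num_cycles_def card_image)
qed

lemma zeta_permutes: "zeta n permutes {1..n}"
  using cycle_permutes[of "[1..<Suc n]"]
  by (simp add: zeta_def atLeastLessThanSuc_atLeastAtMost del: upt_Suc)

lemma num_cycles_zeta:
  assumes "1 \<le> n"
  shows "num_cycles n (zeta n) = 1"
proof -
  have suc: "orbit (zeta n) (Suc x) = orbit (zeta n) 1" if "Suc x \<le> n" for x
    using that
  proof (induction x)
    case (Suc x)
    then show ?case
      using permutation_orbit_step[OF permutation_if_permutes[OF zeta_permutes], of n "Suc x"]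
      by (simp add: zeta_apply)
  qed simp
  have "orbit (zeta n) x = (\<lambda>_. orbit (zeta n) 1) x" if "x \<in> {1..n}" for x
    using suc[of "x - 1"] that by (metis One_nat_def Suc_pred atLeastAtMost_iff less_eq_Suc_le)
  then have "orbit (zeta n) ` {1..n} = (\<lambda>_. orbit (zeta n) 1) ` {1..n}"
    by (rule image_cong[OF refl])
  also have "\<dots> = {orbit (zeta n) 1}"
    using assms by (intro image_constant[of 1]) simp
  finally have "orbit (zeta n) ` {1..n} = {orbit (zeta n) 1}" .
  then show ?thesis by (simp add: num_cycles_def)
qed

section \<open>Subadditivity of cycle counts\<close>

text \<open>Detaching makes \<open>f x\<close> a fixed point and keeps those already present, so the
  number of non-fixed points serves as induction measure below.\<close>

lemma nonfixed_detach_psubset: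
  assumes "inj f" "f x \<noteq> x"
  shows "{w. (f \<circ> transpose x (f x)) w \<noteq> w} \<subset> {w. f w \<noteq> w}"
proof
  show "{w. (f \<circ> transpose x (f x)) w \<noteq> w} \<subseteq> {w. f w \<noteq> w}"
  proof
    fix w
    assume "w \<in> {w. (f \<circ> transpose x (f x)) w \<noteq> w}"
    then show "w \<in> {w. f w \<noteq> w}"
      using assms by (cases "w = x"; cases "w = f x") (auto simp: inj_eq)
  qed
  have "f x \<in> {w. f w \<noteq> w} - {w. (f \<circ> transpose x (f x)) w \<noteq> w}"
    using assms by (simp add: inj_eq)
  then show "{w. (f \<circ> transpose x (f x)) w \<noteq> w} \<noteq> {w. f w \<noteq> w}" by blast
qed

lemma finite_nonfixed:
  assumes "p permutes {1..n::nat}"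
  shows "finite {w. p w \<noteq> w}"
  by (rule finite_subset[of _ "{1..n}"]) (use assms in \<open>auto simp: permutes_def\<close>)

text \<open>This is the source of genus >= 0: it is applied later with \<open>p \<circ> q\<close> an
  \<open>n\<close>-cycle. Moving a transposition from \<open>p\<close> to \<open>q\<close> keeps the
  product, adds a cycle to \<open>p\<close> and removes at most one from \<open>q\<close>; the
  induction ends at \<open>p = id\<close>.\<close>

lemma num_cycles_subadd:
  assumes "p permutes {1..n}" "q permutes {1..n}"
  shows "num_cycles n p + num_cycles n q \<le> n + num_cycles n (p \<circ> q)"
  using assms
proof (induction "card {w. p w \<noteq> w}" arbitrary: p q rule: less_induct)
  case less
  note p = less.prems(1) and q = less.prems(2)
  show ?case
  proof (cases "p = id")
    case True
    then show ?thesis by (simp add: num_cycles_id)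
  next
    case False
    then obtain x where x: "p x \<noteq> x" by (auto simp: fun_eq_iff)
    let ?y = "p x"
    have xS: "x \<in> {1..n}" using x p by (auto simp: permutes_def)
    have yS: "?y \<in> {1..n}" using permutes_in_image[OF p] xS by auto
    let ?t = "transpose x ?y"
    have t: "?t permutes {1..n}" using permutes_swap_id[OF xS yS] .
    have "card {w. (p \<circ> ?t) w \<noteq> w} < card {w. p w \<noteq> w}"
      using nonfixed_detach_psubset[OF permutes_inj[OF p] x] finite_nonfixed[OF p]
      by (rule psubset_card_mono[rotated])
    from less.hyps[OF this permutes_compose[OF t p] permutes_compose[OF q t]]
    moreover have "p \<circ> ?t \<circ> (?t \<circ> q) = p \<circ> q"
      by (simp add: fun_eq_iff)
    ultimately have "num_cycles n (p \<circ> ?t) + num_cycles n (?t \<circ> q) \<le> n + num_cycles n (p \<circ> q)"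
      by simp
    moreover have "num_cycles n (p \<circ> ?t) = num_cycles n p + 1"
      using num_cycles_detach[OF p xS x] .
    \<comment> \<open>The bound concerns multiplication on the right; commuting the factors under
      the cycle count moves \<open>?t\<close> there.\<close>
    moreover have "num_cycles n q \<le> num_cycles n (?t \<circ> q) + 1"
      using num_cycles_transpose_bounds[OF q xS yS] num_cycles_comp_commute[OF q t] by simp
    ultimately show ?thesis by simp
  qed
qed

section \<open>Planar permutations have genus at most 0\<close>

text \<open>
  The open arc of the cyclic order; the second case adds all numbers outside \<open>{1..n}\<close>, which are
  fixed points anyway, so that \<open>n\<close> need not be a parameter.
\<close>

definition arc :: "nat \<Rightarrow> nat \<Rightarrow> nat set" where
  "arc x y = (if x < y then {x<..<y} else {w. w < y \<or> x < w})"

text \<open>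
  For permutations this says at once that the cycles are increasing up to rotation and that they
  do not cross.
\<close>

definition planar :: "(nat \<Rightarrow> nat) \<Rightarrow> bool" where
  "planar f \<longleftrightarrow> (\<forall>x. \<forall>u \<in> arc x (f x). f u \<in> arc x (f x))"

lemma planar_orbit_subset_arc:
  assumes "planar p" "u \<in> arc x (p x)"
  shows "orbit p u \<subseteq> arc x (p x)"
  using assms by (intro orbit_subset_if_invariant) (auto simp: planar_def)

text \<open>An orbit that meets the arc stays inside it, but the open arc omits
  \<open>x\<close>.\<close>

lemma planar_arc_disjoint_orbit:
  assumes p: "p permutes {1..n}" and pl: "planar p" and u: "u \<in> arc x (p x)"
  shows "u \<notin> orbit p x"
proof
  assume "u \<in> orbit p x"
  then have "x \<in> orbit p u"
    using orbit_eq_if_mem[OF p] self_in_orbit[OF p] by blast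
  then show False
    using planar_orbit_subset_arc[OF pl u] by (auto simp: arc_def split: if_splits)
qed

text \<open>Only one cycle changes: it now bypasses \<open>p x\<close>, and deleting a point from a
  cycle creates no crossing.\<close>

lemma planar_detach:
  assumes p: "p permutes {1..n}" and pl: "planar p" and x: "x < p x"
  shows "planar (p \<circ> transpose x (p x))"
  unfolding planar_def
proof (intro allI ballI)
  let ?y = "p x" and ?q = "p \<circ> transpose x (p x)"
  fix w u assume u: "u \<in> arc w (?q w)"
  have eq: "?q v = (if v = x then p ?y else if v = ?y then ?y else p v)" for v
    using x by (simp add: transpose_def)
  have inj: "p a = p b \<longleftrightarrow> a = b" for a b
    using permutes_inj[OF p] by (simp add: inj_eq)
  have clo: "p v \<in> arc a (p a)" if "v \<in> arc a (p a)" for a v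
    using pl that by (auto simp: planar_def)
  consider "w = ?y" | "w = x" | "w \<noteq> x" "w \<noteq> ?y" by blast
  then show "?q u \<in> arc w (?q w)"
  proof cases
    case 1
    \<comment> \<open>\<open>?y\<close> is now a fixed point, and its arc is everything except
      \<open>?y\<close> itself.\<close>
    then have qw: "?q w = w" and uw: "u \<noteq> w" using u by (auto simp: eq arc_def)
    moreover have "inj ?q"
      using permutes_inj[OF p] by (simp add: inj_compose)
    ultimately have "?q u \<noteq> w" by (metis injD)
    with qw show ?thesis by (auto simp: arc_def)
  next
    case 2
    \<comment> \<open>The arc at \<open>x\<close> now ends at \<open>p ?y\<close>. As
      \<open>p ?y\<close> is not inside the arc from \<open>x\<close> to \<open>?y\<close>, the new
      arc consists of the old arcs at \<open>x\<close> and \<open>?y\<close>, glued at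
      \<open>?y\<close>.\<close>
    have "p ?y \<in> orbit p x"
      by (intro orbit.intros)
    then have "p ?y \<notin> arc x ?y"
      using planar_arc_disjoint_orbit[OF p pl] by blast
    moreover have "p ?y \<noteq> ?y"
      using inj x by auto
    ultimately have z: "p ?y \<le> x \<or> ?y < p ?y"
      using x by (auto simp: arc_def)
    have "u \<noteq> x" "u \<in> arc x (p ?y)"
      using u 2 by (auto simp: eq arc_def split: if_splits)
    then have "u = ?y \<or> u \<in> arc x ?y \<or> u \<noteq> ?y \<and> u \<noteq> x \<and> u \<in> arc ?y (p ?y)"
      using z x by (auto simp: arc_def split: if_splits)
    then consider "u = ?y" | "u \<in> arc x ?y" | "u \<noteq> ?y" "u \<noteq> x" "u \<in> arc ?y (p ?y)"
      by blast
    then show ?thesis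
    proof cases
      case 3
      then show ?thesis
        using clo[of u ?y] z x 2 by (auto simp: arc_def eq split: if_splits)
    next
      case 2
      then have "p u \<in> arc x ?y" "?q u = p u"
        using clo[of u x] x by (auto simp: arc_def eq)
      then show ?thesis
        using z x \<open>w = x\<close> by (auto simp: arc_def eq split: if_splits)
    qed (use z x 2 in \<open>auto simp: arc_def eq\<close>)
  next
    case 3
    \<comment> \<open>The arc at \<open>w\<close> is an old one. If it contains \<open>x\<close>, it
      contains \<open>?y\<close> and \<open>p ?y\<close> as well, so bypassing \<open>?y\<close>
      keeps it closed.\<close>
    then show ?thesis
      using u clo[of u w] clo[of ?y w] clo[of x w] unfolding eq by metis
  qed
qed

text \<open>Take the largest \<open>x\<close> with \<open>x < p x\<close>. The numbers between
  \<open>x\<close> and \<open>p x\<close> are closed under \<open>p\<close> by planarity, so a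
  non-fixed one among them would yield a larger ascent.\<close>

lemma planar_exists_arc_of_fixed:
  assumes p: "p permutes {1..n}" and pl: "planar p" and "p \<noteq> id"
  shows "\<exists>x. x < p x \<and> (\<forall>u \<in> {x<..<p x}. p u = u)"
proof -
  \<comment> \<open>In a set closed under \<open>p\<close>, the least non-fixed point ascends: its
    image is again a non-fixed point of the set.\<close>
  have up: "\<exists>x \<in> A. x < p x" if "a \<in> A" "p a \<noteq> a" "\<And>u. u \<in> A \<Longrightarrow> p u \<in> A" for a A
  proof -
    define b where "b = (LEAST b. b \<in> A \<and> p b \<noteq> b)"
    have b: "b \<in> A" "p b \<noteq> b"
      using LeastI[of "\<lambda>b. b \<in> A \<and> p b \<noteq> b" a] that by (auto simp: b_def)
    have "p (p b) \<noteq> p b"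
      using b permutes_inj[OF p] by (simp add: inj_eq)
    then have "b \<le> p b"
      unfolding b_def using that(3) b by (intro Least_le) (simp add: b_def)
    then show ?thesis using b by (intro bexI[of _ b]) auto
  qed
  let ?U = "{x. x < p x}"
  have "?U \<subseteq> {1..n}"
    using p by (metis (mono_tags, lifting) less_irrefl mem_Collect_eq permutes_def subsetI)
  then have fin: "finite ?U" by (rule finite_subset) simp
  obtain a where "p a \<noteq> a" using \<open>p \<noteq> id\<close> by (auto simp: fun_eq_iff)
  then have "?U \<noteq> {}" using up[of a UNIV] by auto
  define x where "x = Max ?U"
  have x: "x < p x"
    using Max_in[OF fin \<open>?U \<noteq> {}\<close>] by (simp add: x_def)
  have "p u = u" if u: "u \<in> {x<..<p x}" for u
  proof (rule ccontr)
    assume "p u \<noteq> u"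
    moreover have "p v \<in> {x<..<p x}" if "v \<in> {x<..<p x}" for v
      using pl x that unfolding planar_def arc_def by (metis (full_types))
    ultimately obtain v where v: "v \<in> {x<..<p x}" "v < p v"
      using up[OF u] by blast
    then have "v \<le> x" unfolding x_def using fin by (intro Max_ge) auto
    with v show False by simp
  qed
  with x show ?thesis by blast
qed

text \<open>Detaching at an ascent over fixed points only adds a cycle to \<open>p\<close> and
  merges two cycles of \<open>inv p \<circ> zeta n\<close>. The sum is thus unchanged down to
  \<open>id\<close>, where it is \<open>n + 1\<close>.\<close>

lemma planar_num_cycles:
  assumes "p permutes {1..n}" "planar p" "1 \<le> n"
  shows "n + 1 \<le> num_cycles n p + num_cycles n (inv p \<circ> zeta n)"
  using assms(1,2)
proof (induction "card {w. p w \<noteq> w}" arbitrary: p rule: less_induct)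
  case less
  note p = less.prems(1) and pl = less.prems(2)
  show ?case
  proof (cases "p = id")
    case True
    then show ?thesis using num_cycles_zeta[OF \<open>1 \<le> n\<close>] by (simp add: num_cycles_id)
  next
    case False
    then obtain x where x: "x < p x" and fixed: "\<And>u. u \<in> {x<..<p x} \<Longrightarrow> p u = u"
      using planar_exists_arc_of_fixed[OF p pl] by blast
    let ?y = "p x"
    have xS: "x \<in> {1..n}" using x p by (metis less_irrefl permutes_def)
    have yS: "?y \<in> {1..n}" using permutes_in_image[OF p] xS by auto
    let ?t = "transpose x ?y" and ?k = "inv p \<circ> zeta n"
    have t: "?t permutes {1..n}" using permutes_swap_id[OF xS yS] .
    have k: "?k permutes {1..n}"
      using permutes_compose[OF zeta_permutes permutes_inv[OF p]] .
    have "card {w. (p \<circ> ?t) w \<noteq> w} < card {w. p w \<noteq> w}"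
      using nonfixed_detach_psubset[OF permutes_inj[OF p]] x finite_nonfixed[OF p]
      by (intro psubset_card_mono) auto
    from less.hyps[OF this permutes_compose[OF t p] planar_detach[OF p pl x]]
    have "n + 1 \<le> num_cycles n (p \<circ> ?t) + num_cycles n (inv (p \<circ> ?t) \<circ> zeta n)" .
    also have "inv (p \<circ> ?t) = ?t \<circ> inv p"
      using o_inv_distrib[OF permutes_bij[OF p] permutes_bij[OF t]] by simp
    also have "?t \<circ> inv p \<circ> zeta n = ?t \<circ> ?k" by (simp add: comp_assoc)
    also have "num_cycles n (?t \<circ> ?k) = num_cycles n (?k \<circ> ?t)"
      using num_cycles_comp_commute[OF k t] .
    finally have "n + 1 \<le> num_cycles n (p \<circ> ?t) + num_cycles n (?k \<circ> ?t)" .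
    moreover have "num_cycles n (p \<circ> ?t) = num_cycles n p + 1"
      using num_cycles_detach[OF p xS] x by simp
    moreover have "num_cycles n ?k = num_cycles n (?k \<circ> ?t) + 1"
    proof (rule num_cycles_join[OF k xS yS])
      \<comment> \<open>From \<open>x\<close> up to \<open>?y - 1\<close>, the map \<open>?k\<close>
        adds 1, except that it sends \<open>?y - 1\<close> back to \<open>x\<close>; so the orbit of
        \<open>x\<close> never reaches \<open>?y\<close>.\<close>
      have "orbit ?k x \<subseteq> {x..<?y}"
      proof (rule orbit_subset_if_invariant)
        fix a assume a: "a \<in> {x..<?y}"
        then have z: "zeta n a = a + 1"
          using xS yS by (auto simp: zeta_apply)
        have "inv p (a + 1) \<in> {x..<?y}"
        proof (cases "a + 1 = ?y")
          case True
          then show ?thesis using x permutes_inverses(2)[OF p] by simp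
        next
          case False
          then have "p (a + 1) = a + 1" using a by (intro fixed) auto
          then have "inv p (a + 1) = a + 1" using permutes_inverses(2)[OF p] by metis
          then show ?thesis using a False by auto
        qed
        then show "?k a \<in> {x..<?y}" by (simp add: z)
      qed (use x in auto)
      then show "?y \<notin> orbit ?k x" by auto
    qed
    ultimately show ?thesis by simp
  qed
qed

section \<open>From a crossing to a four-coloring\<close>

lemma not_planar_obtains:
  assumes p: "p permutes {1..n}" and "\<not> planar p"
  obtains x u where "x \<in> {1..n}" "u \<in> {1..n}" "p x \<in> {1..n}" "p u \<in> {1..n}"
    "u \<in> arc x (p x)" "p u \<notin> arc x (p x)" "p u \<noteq> p x" "p u \<noteq> u" "p x \<noteq> x"
proof -
  obtain x u where u: "u \<in> arc x (p x)" "p u \<notin> arc x (p x)"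
    using assms(2) by (auto simp: planar_def)
  then have "u \<noteq> x" by (auto simp: arc_def split: if_splits)
  then have ne: "p u \<noteq> p x" using permutes_inj[OF p] by (simp add: inj_eq)
  have "p u \<noteq> u" "p x \<noteq> x" using u ne by (auto simp: arc_def split: if_splits)
  moreover from this have "x \<in> {1..n}" "u \<in> {1..n}"
    using p by (metis permutes_def)+
  ultimately show ?thesis
    using that u ne permutes_in_image[OF p] by metis
qed

text \<open>\<open>u\<close> lies in the open arc and so differs from both \<open>x\<close> and
  \<open>p x\<close>; the first detachment does not change its image.\<close>

lemma num_cycles_detach_two:
  assumes p: "p permutes {1..n}" and "x \<in> {1..n}" "u \<in> {1..n}" "p x \<in> {1..n}"
    "u \<in> arc x (p x)" "p u \<noteq> u" "p x \<noteq> x"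
  shows "num_cycles n (p \<circ> transpose x (p x) \<circ> transpose u (p u)) = num_cycles n p + 2"
proof -
  let ?q = "p \<circ> transpose x (p x)"
  have q: "?q permutes {1..n}"
    using assms by (intro permutes_compose permutes_swap_id)
  have "?q u = p u"
    using assms(5) by (auto simp: transpose_def arc_def split: if_splits)
  then have "num_cycles n (?q \<circ> transpose u (p u)) = num_cycles n ?q + 1"
    using num_cycles_detach[OF q, of u] assms by simp
  then show ?thesis
    using num_cycles_detach[OF p] assms by simp
qed

text \<open>\<open>phi\<close> fixes \<open>A\<close> and arranges the other classes in the order
  \<open>D\<close>, \<open>C\<close>, \<open>B\<close>; \<open>b\<close> and \<open>c\<close> are
  the right ends of the images of \<open>D\<close> and \<open>C\<close>. Within a class
  \<open>phi\<close> is a shift and respects successors; at the right ends the transpositions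
  redirect to the start of the next class. If \<open>C\<close> is empty, then \<open>b = c\<close>
  and they form a 3-cycle.\<close>

lemma phi_zeta:
  assumes h: "1 \<le> i" "i < j" "j \<le> k" "k < l" "l \<le> n"
    and b: "b + k = i + l" and c: "c + j = i + l"
  shows "phi (i, j, k, l) \<circ> zeta n = zeta n \<circ> transpose i c \<circ> transpose b l \<circ> phi (i, j, k, l)"
    (is "?f \<circ> _ = _")
proof
  fix x
  let ?s = "\<lambda>w. transpose i c (transpose b l w)"
  have out: "zeta n w = w" if "w = 0 \<or> n < w" for w
    using that zeta_permutes[of n] by (auto simp: permutes_def)
  have step: "zeta n w = w + 1" if "1 \<le> w" "w < n" for w
    using that by (simp add: zeta_apply)
  have last: "zeta n n = 1"
    using h by (simp add: zeta_apply)
  have order: "i < b" "b \<le> c" "c < l" using h b c by linarith+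
  have fA: "?f w = w" if "w \<le> i \<or> l < w" for w
    using h that by (auto simp: phi_def color_B_def color_C_def color_D_def)
  have fB: "?f w = w + l - j" if "i < w" "w \<le> j" for w
    using h that by (auto simp: phi_def color_B_def)
  have fC: "?f w = w + i + l - j - k" if "j < w" "w \<le> k" for w
    using h that by (auto simp: phi_def color_B_def color_C_def)
  have fD: "?f w = w + i - k" if "k < w" "w \<le> l" for w
    using h that by (auto simp: phi_def color_B_def color_C_def color_D_def)
  have s: "?s w = w" if "w \<noteq> i" "w \<noteq> b" "w \<noteq> c" "w \<noteq> l" for w
    using that by simp
  have si: "?s i = c" and sb: "?s b = l" using order by (auto simp: transpose_def)
  have sc: "?s c = i" and sl: "?s l = b" if "b < c" using order that by (auto simp: transpose_def)
  have sl': "?s l = i" if "b = c" using order that by (auto simp: transpose_def)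
  \<comment> \<open>The cases are the right ends \<open>i\<close>, \<open>j\<close>,
    \<open>k\<close>, \<open>l\<close>, the number \<open>n\<close>, the stretches in between and
    the outside; \<open>x = k\<close> differs from \<open>x = j\<close> only if \<open>C\<close> is
    nonempty.\<close>
  consider "x = 0 \<or> n < x" | "1 \<le> x" "x < i" | "x = i" | "i < x" "x < j" | "x = j"
    | "j < x" "x < k" | "x = k" "j < k" | "k < x" "x < l" | "x = l" | "l < x" "x < n"
    | "l < x" "x = n"
    using h(3) by (metis less_one linorder_neqE_nat not_less order_le_less)
  then have "?f (zeta n x) = zeta n (?s (?f x))"
  proof cases
    case 1
    then have "?f x = x" using h by (intro fA) auto
    moreover have "?s x = x" using 1 h order by (intro s) auto
    ultimately show ?thesis using 1 by (simp add: out)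
  next
    case 2
    then have "?s x = x" using h order by (intro s) auto
    then show ?thesis using 2 h by (simp add: step fA)
  next
    case 3
    then have "?f (i + 1) = c + 1" using h c by (simp add: fB)
    then show ?thesis using 3 h order by (simp add: step fA si)
  next
    case 4
    define w where "w = x + l - j"
    have "w + j = x + l" using 4 h by (simp add: w_def)
    then have "c < w" "w < l" using 4 h c by linarith+
    moreover have "?f x = w" using 4 by (simp add: fB w_def)
    moreover have "?f (x + 1) = w + 1" using 4 h by (simp add: fB w_def)
    moreover have "?s w = w" using calculation order by (intro s) auto
    ultimately show ?thesis using 4 h by (simp add: step)
  next
    case 5
    \<comment> \<open>The successor of \<open>j\<close> lies in \<open>D\<close> if \<open>C\<close>
      is empty and in \<open>C\<close> otherwise.\<close>
    have "?f (j + 1) = zeta n (?s l)"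
    proof (cases "j = k")
      case True
      then have "b = c" using b c by linarith
      moreover have "?f (k + 1) = i + 1" using h by (simp add: fD)
      moreover have "zeta n i = i + 1" using h by (simp add: step)
      ultimately show ?thesis using True sl' by metis
    next
      case False
      then have "?f (j + 1) = b + 1" "b < c" using h b c by (simp_all add: fC)
      then show ?thesis using h order by (simp add: sl step)
    qed
    then show ?thesis using 5 h by (simp add: fB step)
  next
    case 6
    define w where "w = x + i + l - j - k"
    have "w + j + k = x + i + l" using 6 h by (simp add: w_def)
    then have "b < w" "w < c" using 6 h b c by linarith+
    moreover have "?f x = w" using 6 by (simp add: fC w_def)
    moreover have "?f (x + 1) = w + 1" using 6 h by (simp add: fC w_def)
    moreover have "?s w = w" using calculation order by (intro s) auto
    ultimately show ?thesis using 6 h order by (simp add: step)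
  next
    case 7
    then have "?f k = c" using h c by (simp add: fC)
    moreover have "?f (k + 1) = i + 1" using h by (simp add: fD)
    moreover have "b < c" using 7 b c by linarith
    ultimately show ?thesis using 7 h by (simp add: sc step)
  next
    case 8
    define w where "w = x + i - k"
    have "w + k = x + i" using 8 h by (simp add: w_def)
    then have "i < w" "w < b" using 8 h b by linarith+
    moreover have "?f x = w" using 8 by (simp add: fD w_def)
    moreover have "?f (x + 1) = w + 1" using 8 h by (simp add: fD w_def)
    moreover have "?s w = w" using calculation order by (intro s) auto
    ultimately show ?thesis using 8 h order by (simp add: step)
  next
    case 9
    have "?f l = b" using h b by (simp add: fD)
    moreover have "?f (zeta n l) = zeta n l"
    proof (cases "l = n")
      case True
      have "?f 1 = 1" using h by (intro fA) simp
      then show ?thesis using True last by simp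
    next
      case False
      then show ?thesis using h by (simp add: step fA)
    qed
    ultimately show ?thesis using 9 sb by simp
  next
    case 10
    then have "?s x = x" using h order by (intro s) auto
    then show ?thesis using 10 h by (simp add: step fA)
  next
    case 11
    then have "?s x = x" using h order by (intro s) auto
    then show ?thesis using 11 h by (simp add: last fA)
  qed
  then show "(?f \<circ> zeta n) x = (zeta n \<circ> transpose i c \<circ> transpose b l \<circ> ?f) x"
    by simp
qed

lemma transpose_comp_commute:
  assumes "x \<noteq> u" "x \<noteq> v" "y \<noteq> u" "y \<noteq> v"
  shows "transpose x y \<circ> transpose u v = transpose u v \<circ> transpose x y"
proof
  show "(transpose x y \<circ> transpose u v) w = (transpose u v \<circ> transpose x y) w" for w
    using assms by (cases "w = x"; cases "w = y"; cases "w = u"; cases "w = v") simp_all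
qed

text \<open>Both sides are the 3-cycle taking \<open>u\<close> to \<open>y\<close>, \<open>y\<close>
  to \<open>x\<close> and \<open>x\<close> to \<open>u\<close>.\<close>

lemma transpose_comp_rotate:
  assumes "x \<noteq> u" "u \<noteq> y" "y \<noteq> x"
  shows "transpose x y \<circ> transpose u x = transpose u y \<circ> transpose y x"
proof
  show "(transpose x y \<circ> transpose u x) w = (transpose u y \<circ> transpose y x) w" for w
    using assms by (cases "w = x"; cases "w = y"; cases "w = u") simp_all
qed

lemma crossing_coloring:
  assumes mem: "x \<in> {1..n}" "u \<in> {1..n}" "y \<in> {1..n}" "v \<in> {1..n}"
    and u: "u \<in> arc x y" and v: "v \<notin> arc x y" "v \<noteq> y"
  shows "\<exists>\<gamma>. four_coloring n \<gamma> \<and>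
    phi \<gamma> \<circ> zeta n = zeta n \<circ> transpose x y \<circ> transpose u v \<circ> phi \<gamma>"
proof -
  have coloring: ?thesis
    if h: "1 \<le> a" "a < b" "b \<le> c" "c < d" "d \<le> n"
      and eq: "transpose x y \<circ> transpose u v = transpose a c \<circ> transpose b d" for a b c d
  proof -
    \<comment> \<open>With \<open>i = a\<close> and \<open>l = d\<close>, the second and third
      entries solve the equations \<open>c + j = i + l\<close> and \<open>b + k = i + l\<close> of
      \<open>phi_zeta\<close>.\<close>
    let ?g = "(a, a + d - c, a + d - b, d)"
    have "phi ?g \<circ> zeta n = zeta n \<circ> (transpose x y \<circ> transpose u v) \<circ> phi ?g"
      unfolding eq comp_assoc[symmetric] using h by (intro phi_zeta) auto
    moreover have "four_coloring n ?g"
      using h by (auto simp: four_coloring_def)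
    ultimately show ?thesis by (metis comp_assoc)
  qed
  have "x < u \<and> u < y \<and> y < v \<or> v < x \<and> x < u \<and> u < y \<or>
      u < y \<and> y < v \<and> v < x \<or> y < v \<and> v < x \<and> x < u \<or>
      v = x \<and> x < u \<and> u < y \<or> v = x \<and> u < y \<and> y < x \<or> v = x \<and> y < x \<and> x < u"
    using u v by (auto simp: arc_def split: if_splits)
  then show ?thesis
  proof (elim disjE conjE)
    assume "x < u" "u < y" "y < v"
    then show ?thesis using mem by (intro coloring[of x u y v]) auto
  next
    assume h: "v < x" "x < u" "u < y"
    have "transpose x y \<circ> transpose u v = transpose v u \<circ> transpose x y"
      using transpose_comp_commute[of x u v y] h by (simp add: transpose_commute)
    then show ?thesis using mem h by (intro coloring[of v x u y]) auto
  next
    assume h: "u < y" "y < v" "v < x"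
    have "transpose x y \<circ> transpose u v = transpose u v \<circ> transpose y x"
      using transpose_comp_commute[of x u v y] h by (simp add: transpose_commute)
    then show ?thesis using mem h by (intro coloring[of u y v x]) auto
  next
    assume h: "y < v" "v < x" "x < u"
    have "transpose x y \<circ> transpose u v = transpose y x \<circ> transpose v u"
      using h by (simp add: transpose_commute)
    then show ?thesis using mem h by (intro coloring[of y v x u]) auto
  next
    assume h: "v = x" "x < u" "u < y"
    have "transpose x y \<circ> transpose u v = transpose x u \<circ> transpose u y"
      using transpose_comp_rotate[of u y x] h by (simp add: transpose_commute)
    then show ?thesis using mem h by (intro coloring[of x u u y]) auto
  next
    assume h: "v = x" "u < y" "y < x"
    have "transpose x y \<circ> transpose u v = transpose u y \<circ> transpose y x"
      using transpose_comp_rotate[of x u y] h by simp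
    then show ?thesis using mem h by (intro coloring[of u y y x]) auto
  next
    assume h: "v = x" "y < x" "x < u"
    have "transpose x y \<circ> transpose u v = transpose y x \<circ> transpose x u"
      using h by (simp add: transpose_commute)
    then show ?thesis using mem h by (intro coloring[of y x x u]) auto
  qed
qed

text \<open>The reduction is used twice: on \<open>inv \<alpha> \<circ> zeta n\<close> in the
  theorem, and in the proof by contradiction that genus 0 forces planarity.\<close>

lemma not_planar_coloring:
  assumes p: "p permutes {1..n}" and npl: "\<not> planar p"
  shows "\<exists>\<gamma> \<sigma>. four_coloring n \<gamma> \<and> \<sigma> permutes {1..n} \<and>
    num_cycles n (p \<circ> \<sigma>) = num_cycles n p + 2 \<and>
    zeta n \<circ> \<sigma> = phi \<gamma> \<circ> zeta n \<circ> inv (phi \<gamma>)"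
proof -
  from p npl obtain x u where xu: "x \<in> {1..n}" "u \<in> {1..n}" "p x \<in> {1..n}" "p u \<in> {1..n}"
    "u \<in> arc x (p x)" "p u \<notin> arc x (p x)" "p u \<noteq> p x" "p u \<noteq> u" "p x \<noteq> x"
    by (rule not_planar_obtains)
  let ?s = "transpose x (p x) \<circ> transpose u (p u)"
  obtain \<gamma> where \<gamma>: "four_coloring n \<gamma>" and eq:
    "phi \<gamma> \<circ> zeta n = zeta n \<circ> transpose x (p x) \<circ> transpose u (p u) \<circ> phi \<gamma>"
    using crossing_coloring[of x n u "p x" "p u"] xu by blast
  have "phi \<gamma> \<circ> zeta n \<circ> inv (phi \<gamma>) = zeta n \<circ> ?s"
    unfolding eq using permutes_inv_o(1)[OF phi_permutes[OF \<gamma>]] by (simp add: comp_assoc)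
  moreover have "?s permutes {1..n}"
    using xu by (intro permutes_compose permutes_swap_id)
  moreover have "num_cycles n (p \<circ> ?s) = num_cycles n p + 2"
    using num_cycles_detach_two[OF p] xu by (simp add: comp_assoc)
  ultimately show ?thesis using \<gamma> by metis
qed

text \<open>A crossing would give a factorization of an \<open>n\<close>-cycle with at least
  \<open>n + 3\<close> cycles in total, whereas subadditivity allows at most
  \<open>n + 1\<close>.\<close>

lemma planar_if_num_cycles:
  assumes p: "p permutes {1..n}" and n: "1 \<le> n"
    and z: "n + 1 \<le> num_cycles n p + num_cycles n (inv p \<circ> zeta n)"
  shows "planar p"
proof (rule ccontr)
  assume "\<not> planar p"
  then obtain \<gamma> \<sigma> where \<gamma>: "four_coloring n \<gamma>" and \<sigma>: "\<sigma> permutes {1..n}"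
    and two: "num_cycles n (p \<circ> \<sigma>) = num_cycles n p + 2"
    and eq: "zeta n \<circ> \<sigma> = phi \<gamma> \<circ> zeta n \<circ> inv (phi \<gamma>)"
    using not_planar_coloring[OF p] by blast
  have k: "inv p \<circ> zeta n permutes {1..n}"
    using permutes_compose[OF zeta_permutes permutes_inv[OF p]] .
  have k': "inv \<sigma> \<circ> (inv p \<circ> zeta n) \<circ> \<sigma> permutes {1..n}"
    using permutes_compose[OF \<sigma> permutes_compose[OF k permutes_inv[OF \<sigma>]]] .
  have conj: "num_cycles n (inv \<sigma> \<circ> (inv p \<circ> zeta n) \<circ> \<sigma>) = num_cycles n (inv p \<circ> zeta n)"
    using num_cycles_conj[OF k permutes_inv[OF \<sigma>]] permutes_inv_inv[OF \<sigma>] by simp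
  \<comment> \<open>Conjugating the second factor preserves its cycle count and makes the product
    \<open>zeta n \<circ> \<sigma>\<close>, a conjugate of \<open>zeta n\<close>.\<close>
  have "p \<circ> \<sigma> \<circ> (inv \<sigma> \<circ> (inv p \<circ> zeta n) \<circ> \<sigma>) = zeta n \<circ> \<sigma>"
    using permutes_inverses(1)[OF p] permutes_inverses(1)[OF \<sigma>] by (simp add: fun_eq_iff)
  then have "num_cycles n (p \<circ> \<sigma>) + num_cycles n (inv p \<circ> zeta n)
      \<le> n + num_cycles n (zeta n \<circ> \<sigma>)"
    using num_cycles_subadd[OF permutes_compose[OF \<sigma> p] k'] conj by (simp only:)
  also have "num_cycles n (zeta n \<circ> \<sigma>) = 1"
    unfolding eq using num_cycles_conj[OF zeta_permutes phi_permutes[OF \<gamma>]]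
    by (simp add: num_cycles_zeta[OF n])
  finally show False using two z by linarith
qed

section \<open>Planar permutations as noncrossing partitions\<close>

text \<open>No point of the orbit of \<open>x\<close> lies inside the arc from \<open>x\<close> to
  \<open>p x\<close>, so \<open>p\<close> moves on to the next larger one;
  \<open>planar_wrap\<close> is the analogue for the largest point, which returns to the
  least.\<close>

lemma planar_next:
  assumes p: "p permutes {1..n}" and pl: "planar p" and y: "y \<in> orbit p x" "x < y"
  shows "x < p x" "p x \<le> y"
proof -
  have "y \<notin> arc x (p x)" using planar_arc_disjoint_orbit[OF p pl] y by blast
  then show "x < p x" "p x \<le> y" using y by (auto simp: arc_def split: if_splits)
qed

lemma planar_wrap:
  assumes p: "p permutes {1..n}" and pl: "planar p"
    and max: "\<And>w. w \<in> orbit p x \<Longrightarrow> w \<le> x" and y: "y \<in> orbit p x"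
  shows "p x \<le> y"
proof -
  have "p x \<le> x" using max orbit.base by metis
  moreover have "y \<notin> arc x (p x)" using planar_arc_disjoint_orbit[OF p pl] y by blast
  ultimately show ?thesis by (auto simp: arc_def)
qed

lemma cycle_of_list_nth:
  assumes "distinct xs" "i < length xs"
  shows "cycle_of_list xs (xs ! i) = xs ! (Suc i mod length xs)"
proof -
  have "map (cycle_of_list xs) xs = rotate1 xs"
    using cyclic_rotation[OF assms(1), of 1] by simp
  then have "map (cycle_of_list xs) xs ! i = rotate1 xs ! i" by simp
  then show ?thesis using assms by (simp add: nth_rotate1)
qed

lemma planar_cycle_of_list:
  assumes p: "p permutes {1..n}" and pl: "planar p"
  shows "cycle_of_list (sorted_list_of_set (orbit p x)) x = p x"
proof -
  define xs where "xs = sorted_list_of_set (orbit p x)"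
  have fin: "finite (orbit p x)"
    using finite_orbit[OF self_in_orbit[OF p]] .
  have set: "set xs = orbit p x" and dist: "distinct xs" and sorted: "sorted_wrt (<) xs"
    using fin by (auto simp: xs_def)
  have nth_less: "xs ! i < xs ! j \<longleftrightarrow> i < j" if "i < length xs" "j < length xs" for i j
    using that sorted by (metis linorder_neqE_nat not_less_iff_gr_or_eq sorted_wrt_nth_less)
  obtain i where i: "i < length xs" "x = xs ! i"
    using self_in_orbit[OF p] set by (metis in_set_conv_nth)
  obtain j where j: "j < length xs" "p x = xs ! j"
    using orbit.base[of p x] set by (metis in_set_conv_nth)
  have "j = Suc i mod length xs"
  proof (cases "Suc i < length xs")
    case True
    then have "xs ! Suc i \<in> orbit p x" using set nth_mem by blast
    moreover have "x < xs ! Suc i" using nth_less i True by simp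
    ultimately have "x < p x" "p x \<le> xs ! Suc i" using planar_next[OF p pl] by auto
    then have "i < j" "\<not> Suc i < j"
      using nth_less[OF i(1) j(1)] nth_less[OF True j(1)] i j by auto
    then show ?thesis using True by simp
  next
    case False
    then have len: "length xs = Suc i" using i by simp
    have "w \<le> x" if w: "w \<in> orbit p x" for w
    proof -
      obtain m where m: "m < length xs" "w = xs ! m" using w set by (metis in_set_conv_nth)
      then have "\<not> x < w" unfolding i(2) m(2) nth_less[OF i(1) m(1)] using len by simp
      then show ?thesis by simp
    qed
    moreover have "xs ! 0 \<in> orbit p x" using set len by (metis nth_mem zero_less_Suc)
    ultimately have "p x \<le> xs ! 0" using planar_wrap[OF p pl] by blast
    then have "j = 0" using nth_less[of 0 j] j len by auto
    then show ?thesis using len by simp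
  qed
  then show ?thesis
    using cycle_of_list_nth[OF dist i(1)] i(2) j(2) unfolding xs_def[symmetric] by metis
qed

lemma partition_on_orbits:
  assumes p: "p permutes {1..n::nat}"
  shows "partition_on {1..n} (orbit p ` {1..n})"
proof (rule partition_onI)
  show "\<Union> (orbit p ` {1..n}) = {1..n}"
    using permutes_orbit_subset[OF p] self_in_orbit[OF p] by blast
  show "{} \<notin> orbit p ` {1..n}"
    using orbit_nonempty by (metis imageE)
  show "disjnt U V" if "U \<in> orbit p ` {1..n}" "V \<in> orbit p ` {1..n}" "U \<noteq> V" for U V
    using that orbit_eq_if_mem[OF p] unfolding disjnt_iff by (metis imageE)
qed

lemma planar_block_perm:
  assumes p: "p permutes {1..n}" and pl: "planar p"
  shows "block_perm (orbit p ` {1..n}) = p"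
proof
  fix x
  have un: "\<Union> (orbit p ` {1..n}) = {1..n}"
    using partition_on_orbits[OF p] by (simp add: partition_on_def)
  show "block_perm (orbit p ` {1..n}) x = p x"
  proof (cases "x \<in> {1..n}")
    case True
    have "(THE U. U \<in> orbit p ` {1..n} \<and> x \<in> U) = orbit p x"
      using True self_in_orbit[OF p] orbit_eq_if_mem[OF p] by (intro the_equality) auto
    then show ?thesis
      using True un planar_cycle_of_list[OF p pl] by (simp add: block_perm_def)
  next
    case False
    then show ?thesis
      using un p by (simp only: block_perm_def permutes_def) simp
  qed
qed

lemma planar_noncrossing:
  assumes p: "p permutes {1..n}" and pl: "planar p"
  shows "noncrossing_partition n (orbit p ` {1..n})"
  unfolding noncrossing_partition_def
proof (intro conjI ballI impI notI)
  show "partition_on {1..n} (orbit p ` {1..n})"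
    using partition_on_orbits[OF p] .
  fix X Y
  assume X: "X \<in> orbit p ` {1..n}" and Y: "Y \<in> orbit p ` {1..n}" and ne: "X \<noteq> Y"
    and "\<exists>a\<in>X. \<exists>b\<in>Y. \<exists>a'\<in>X. \<exists>b'\<in>Y. a < b \<and> b < a' \<and> a' < b'"
  then obtain a b a' b' where ab: "a \<in> X" "b \<in> Y" "a' \<in> X" "b' \<in> Y" "a < b" "b < a'" "a' < b'"
    by blast
  have orb: "orbit p w = X" if "w \<in> X" for w
    using X that orbit_eq_if_mem[OF p] by auto
  have orb_b: "orbit p b = Y"
    using Y ab orbit_eq_if_mem[OF p] by auto
  let ?L = "{w \<in> X. w < b}"
  \<comment> \<open>\<open>x\<close> is the last point of \<open>X\<close> before \<open>b\<close>,
    so the arc from \<open>x\<close> to \<open>p x\<close> passes over \<open>b\<close> and ends no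
    later than \<open>a'\<close>. Planarity confines \<open>Y\<close> to it, but \<open>b'\<close>
    lies beyond.\<close>
  define x where "x = Max ?L"
  have fin: "finite ?L" by (rule finite_subset[of _ "{..<b}"]) auto
  have x: "x \<in> X" "x < b"
  proof -
    have "x \<in> ?L" unfolding x_def by (rule Max_in[OF fin]) (use ab in auto)
    then show "x \<in> X" "x < b" by auto
  qed
  have next_x: "x < p x" "p x \<le> a'"
    using planar_next[OF p pl, of a' x] orb[OF x(1)] ab x by auto
  have px: "p x \<in> X" using orb[OF x(1)] orbit.base by metis
  have "\<not> p x < b"
    using Max_ge[OF fin, of "p x"] px next_x(1) unfolding x_def[symmetric] by auto
  moreover have "p x \<noteq> b"
    using orb[OF px] orb_b ne by auto
  ultimately have "b \<in> arc x (p x)"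
    using x next_x by (auto simp: arc_def)
  then have "Y \<subseteq> arc x (p x)"
    using planar_orbit_subset_arc[OF pl] orb_b by blast
  then show False
    using ab next_x by (auto simp: arc_def)
qed

theorem theorem2p8:
  fixes n :: nat and \<alpha> :: "nat \<Rightarrow> nat"
  assumes "\<alpha> permutes {1..n}"
    and "genus n \<alpha> = 1"
  shows "\<exists>P \<gamma>. noncrossing_partition n P \<and> four_coloring n \<gamma> \<and> \<alpha> = Phi P \<gamma>"
proof -
  note a = assms(1)
  let ?k = "inv \<alpha> \<circ> zeta n"
  have "of_nat (num_cycles n \<alpha> + num_cycles n ?k + 1) = (of_nat n :: rat)"
    using assms(2) by (simp add: genus_def)
  then have sum: "num_cycles n \<alpha> + num_cycles n ?k + 1 = n"
    by (simp only: of_nat_eq_iff)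
  then have n: "1 \<le> n" by simp
  have k: "?k permutes {1..n}"
    using permutes_compose[OF zeta_permutes permutes_inv[OF a]] .
  \<comment> \<open>\<open>inv ?k \<circ> zeta n\<close> is \<open>\<alpha>\<close> conjugated by
    \<open>inv (zeta n)\<close>, so passing to \<open>?k\<close> swaps the two cycle counts and
    keeps the genus.\<close>
  have "inv ?k = inv (zeta n) \<circ> \<alpha>"
    using o_inv_distrib[OF permutes_bij[OF permutes_inv[OF a]] permutes_bij[OF zeta_permutes]]
    by (simp add: permutes_inv_inv[OF a])
  then have "num_cycles n (inv ?k \<circ> zeta n) = num_cycles n \<alpha>"
    using num_cycles_conj[OF a permutes_inv[OF zeta_permutes]]
    by (simp add: permutes_inv_inv[OF zeta_permutes])
  then have "\<not> planar ?k"
    using planar_num_cycles[OF k _ n] sum by auto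
  then obtain \<gamma> \<sigma> where \<gamma>: "four_coloring n \<gamma>" and \<sigma>: "\<sigma> permutes {1..n}"
    and two: "num_cycles n (?k \<circ> \<sigma>) = num_cycles n ?k + 2"
    and eq: "zeta n \<circ> \<sigma> = phi \<gamma> \<circ> zeta n \<circ> inv (phi \<gamma>)"
    using not_planar_coloring[OF k] by blast
  let ?f = "phi \<gamma>"
  have f: "?f permutes {1..n}" using phi_permutes[OF \<gamma>] .
  \<comment> \<open>\<open>\<alpha> = Phi P \<gamma>\<close> holds exactly if \<open>\<psi>\<close>
    is \<open>block_perm P\<close>, so planarity of \<open>\<psi>\<close> is the goal.\<close>
  define \<psi> where "\<psi> = inv ?f \<circ> \<alpha> \<circ> ?f"
  have \<psi>: "\<psi> permutes {1..n}"
    unfolding \<psi>_def using a f by (intro permutes_compose permutes_inv)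
  have z\<psi>: "num_cycles n \<psi> = num_cycles n \<alpha>"
    unfolding \<psi>_def using num_cycles_conj[OF a permutes_inv[OF f]]
    by (simp add: permutes_inv_inv[OF f])
  have "inv \<psi> = inv ?f \<circ> inv \<alpha> \<circ> ?f"
  proof (rule inv_unique_comp)
    show "\<psi> \<circ> (inv ?f \<circ> inv \<alpha> \<circ> ?f) = id" "inv ?f \<circ> inv \<alpha> \<circ> ?f \<circ> \<psi> = id"
      using permutes_inverses[OF f] permutes_inverses[OF a] by (simp_all add: \<psi>_def fun_eq_iff)
  qed
  \<comment> \<open>Conjugation by \<open>?f\<close> replaces \<open>zeta n\<close> by
    \<open>zeta n \<circ> \<sigma>\<close>, so the second cycle count rises by two while that of
    \<open>\<alpha>\<close> stays: the genus drops to 0.\<close>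
  then have "?f \<circ> (inv \<psi> \<circ> zeta n) \<circ> inv ?f = inv \<alpha> \<circ> (?f \<circ> zeta n \<circ> inv ?f)"
    using permutes_inverses(1)[OF f] by (simp add: fun_eq_iff)
  also have "\<dots> = ?k \<circ> \<sigma>"
    unfolding eq[symmetric] by (simp add: comp_assoc)
  finally have "num_cycles n (inv \<psi> \<circ> zeta n) = num_cycles n (?k \<circ> \<sigma>)"
    using num_cycles_conj[OF permutes_compose[OF zeta_permutes permutes_inv[OF \<psi>]] f] by simp
  then have pl: "planar \<psi>"
    using planar_if_num_cycles[OF \<psi> n] z\<psi> two sum by simp
  have "\<alpha> = Phi (orbit \<psi> ` {1..n}) \<gamma>"
    unfolding Phi_def planar_block_perm[OF \<psi> pl]
    using permutes_inverses(1)[OF f] by (simp add: \<psi>_def fun_eq_iff)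
  then show ?thesis
    using planar_noncrossing[OF \<psi> pl] \<gamma> by blast
qed

end
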